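(* Let $X$ and $Y$ be asymptotically coarse Lipschitz equivalent Banach spaces. Then there exists an asymptotic coarse Lipschitz equivalence $f:X\to Y$ satisfying the following: there exists $M\ge1$ such that for all $\varepsilon>0$ there is $t_0>0$ such that for any finite codimensional subspace $X_0$ of $X$ and any $t>t_0$, there is a compact subset $K\subset Y$ such that $$\frac{t}{M}B_Y\subset K+\varepsilon tB_Y+f(2tB_{X_0}).$$
   Context: $B_Z$ denotes the closed unit ball of a normed space $Z$. Banach spaces are regarded as metric spaces with the metric $d(x,x')=\|x-x'\|$. Let $(X,d)$ and $(Y,\partial)$ be metric spaces. A map $f:X\to Y$ is coarse Lipschitz if there is $L>0$ such that $\partial(f(x),f(x'))\le L\,d(x,x')+L$ for all $x,x'\in X$. Two maps $f,g:X\to Y$ are asymptotically close, written $f\sim_\infty g$, if for some $x_0\in X$ one has $\lim_{x\to\infty}\frac{\partial(f(x),g(x))}{d(x,x_0)}=0$, where $x\to\infty$ means $d(x,x_0)\to\infty$; if $X$ is bounded, any two maps $X\to Y$ are by convention asymptotically close. $X$ and $Y$ are asymptotically coarse Lipschitz equivalent if there are coarse Lipschitz maps $f:X\to Y$ and $g:Y\to X$ with $g\circ f\sim_\infty \mathrm{Id}_X$ and $f\circ g\sim_\infty \mathrm{Id}_Y$; then $f$ (and $g$) is called an asymptotic coarse Lipschitz equivalence. *)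

theory Defs
  imports "HOL-Analysis.Analysis" "HOL-Library.Set_Algebras"
begin

definition coarse_lipschitz :: "('a::metric_space \<Rightarrow> 'b::metric_space) \<Rightarrow> bool" where
  "coarse_lipschitz f \<longleftrightarrow> (\<exists>L>0. \<forall>x x'. dist (f x) (f x') \<le> L * dist x x' + L)"

text \<open>The filter \<open>filtercomap (\<lambda>x. dist x x0) at_top\<close> expresses \<open>dist x x0 \<rightarrow> \<infinity>\<close>;
  it is used instead of \<^const>\<open>at_infinity\<close>, which needs a normed space.\<close>

definition asymptotically_close ::
    "('a::metric_space \<Rightarrow> 'b::metric_space) \<Rightarrow> ('a \<Rightarrow> 'b) \<Rightarrow> bool" where
  "asymptotically_close f g \<longleftrightarrow>
     bounded (UNIV :: 'a set) \<or>
     (\<exists>x0. ((\<lambda>x. dist (f x) (g x) / dist x x0) \<longlongrightarrow> 0) (filtercomap (\<lambda>x. dist x x0) at_top))"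

definition asymptotic_coarse_lipschitz_equivalence ::
    "('a::metric_space \<Rightarrow> 'b::metric_space) \<Rightarrow> bool" where
  "asymptotic_coarse_lipschitz_equivalence f \<longleftrightarrow>
     coarse_lipschitz f \<and>
     (\<exists>g. coarse_lipschitz g \<and> asymptotically_close (g \<circ> f) id \<and> asymptotically_close (f \<circ> g) id)"

definition asymptotically_coarse_lipschitz_equivalent ::
    "'a::metric_space itself \<Rightarrow> 'b::metric_space itself \<Rightarrow> bool" where
  "asymptotically_coarse_lipschitz_equivalent _ _ \<longleftrightarrow>
     (\<exists>f :: 'a \<Rightarrow> 'b. asymptotic_coarse_lipschitz_equivalence f)"

text \<open>The images of the vectors in \<open>B\<close> span the quotient by \<open>S\<close>. No closedness of \<open>S\<close> is required.\<close>

definition finite_codim_subspace :: "'a::real_vector set \<Rightarrow> bool" where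
  "finite_codim_subspace S \<longleftrightarrow> subspace S \<and> (\<exists>B. finite B \<and> span (S \<union> B) = UNIV)"

end

(*
  Any asymptotic coarse Lipschitz equivalence f, with coarse inverse g, works; M is four times
  a common coarse Lipschitz constant. Given X0 and t, a compact convex polytope C in the ball of
  radius t has the Gorelik property: every coarse Lipschitz map of C moving points by at most t has
  a value within a bounded distance of X0. This is Brouwer's theorem applied to a partition of unity
  smoothing of the map, so no continuity is required. For norm y <= t / M the map
  a |-> g (y + f a) moves the points of C by at most t, hence some g (y + f a) is near some x in X0,
  and then f x is close to y + f a. Since f is coarse Lipschitz, f a may be replaced by f j with j
  in a finite net J of C, so K = - f ` J is even finite.
*)
theory Submission
  imports Defs
begin

section \<open>Brouwer's fixed point theorem on a polytope, from Kuhn's labelling lemma\<close>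

text \<open>Each grid point is labelled, coordinate by coordinate, by whether \<open>F\<close>
  pushes it up or down. Kuhn's lemma yields a small grid cube that carries both labels in every
  coordinate. Near its corner \<open>x\<close> the displacement of \<open>F\<close> thus takes both
  signs, the discrete form of a fixed point.\<close>

lemma kuhn_grid:
  fixes F :: "('v \<Rightarrow> real) \<Rightarrow> 'v \<Rightarrow> real"
  assumes V: "finite V" and p: "0 < p"
    and F: "\<And>x v. \<lbrakk>\<And>u. u \<in> V \<Longrightarrow> x u \<in> {0..1}; v \<in> V\<rbrakk> \<Longrightarrow> F x v \<in> {0..1}"
  obtains x where "\<forall>v\<in>V. x v \<in> {0..1}"
    and "\<forall>v\<in>V. \<exists>r s. (\<forall>u\<in>V. r u \<in> {0..1} \<and> \<bar>r u - x u\<bar> \<le> 1 / real p) \<and>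
           (\<forall>u\<in>V. s u \<in> {0..1} \<and> \<bar>s u - x u\<bar> \<le> 1 / real p) \<and> r v \<le> F r v \<and> F s v \<le> s v"
proof -
  obtain n :: nat and e where e: "e ` V = {i. i < n}" "inj_on e V"
    using finite_imp_inj_to_nat_seg[OF V] by metis
  define d where "d = inv_into V e"
  have d: "d i \<in> V" "e (d i) = i" if "i < n" for i
    using e that unfolding d_def by (auto intro: inv_into_into f_inv_into_f)
  have en: "e v < n" "d (e v) = v" if "v \<in> V" for v
    using e that unfolding d_def by auto
  define X where "X z v = real (z (e v)) / real p" for z :: "nat \<Rightarrow> nat" and v
  \<comment> \<open>The guard \<open>z i < p\<close> gives the upper face label 1 even where
    \<open>F\<close> fixes the coordinate, as Kuhn's lemma demands. On the lower face
    \<open>F\<close> cannot decrease the coordinate, so the label is 0.\<close>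
  define label :: "(nat \<Rightarrow> nat) \<Rightarrow> nat \<Rightarrow> nat"
    where "label z i = (if z i < p \<and> real (z i) / real p \<le> F (X z) (d i) then 0 else 1)" for z i
  have cube: "X z v \<in> {0..1}" if "\<forall>i<n. z i \<le> p" "v \<in> V" for z v
    using that p en(1)[OF that(2)] by (auto simp: X_def divide_le_eq_1)
  have l0: "\<forall>x. (\<forall>i<n. x i \<le> p) \<longrightarrow> (\<forall>i<n. x i = 0 \<longrightarrow> label x i = 0)"
    using F cube d p by (auto simp: label_def)
  have lp: "\<forall>x. (\<forall>i<n. x i \<le> p) \<longrightarrow> (\<forall>i<n. x i = p \<longrightarrow> label x i = 1)"
    by (auto simp: label_def)
  have l01: "\<forall>x. (\<forall>i<n. x i \<le> p) \<longrightarrow> (\<forall>i<n. label x i = 0 \<or> label x i = 1)"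
    by (auto simp: label_def)
  obtain q where q: "\<forall>i<n. q i < p"
    and rs: "\<forall>i<n. \<exists>r s. (\<forall>j<n. q j \<le> r j \<and> r j \<le> q j + 1) \<and>
      (\<forall>j<n. q j \<le> s j \<and> s j \<le> q j + 1) \<and> label r i \<noteq> label s i"
    by (rule kuhn_lemma[OF p l01 l0 lp])
  have step: "X z u \<in> {0..1} \<and> \<bar>X z u - X q u\<bar> \<le> 1 / real p"
    if z: "\<forall>j<n. q j \<le> z j \<and> z j \<le> q j + 1" and u: "u \<in> V" for z u
  proof
    have "\<forall>i<n. z i \<le> p"
      using z q by (metis Suc_eq_plus1 Suc_leI le_trans)
    then show "X z u \<in> {0..1}"
      using cube u by blast
    have "\<bar>real (z (e u)) - real (q (e u))\<bar> \<le> 1"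
      using z en(1)[OF u] by force
    then show "\<bar>X z u - X q u\<bar> \<le> 1 / real p"
      using p by (simp add: X_def flip: diff_divide_distrib) (simp add: divide_right_mono)
  qed
  show ?thesis
  proof (rule that[of "X q"]; rule ballI)
    show "X q v \<in> {0..1}" if "v \<in> V" for v
      using cube[OF _ that] q by (meson less_imp_le)
    fix v assume v: "v \<in> V"
    obtain r s where r: "\<forall>j<n. q j \<le> r j \<and> r j \<le> q j + 1"
      and s: "\<forall>j<n. q j \<le> s j \<and> s j \<le> q j + 1" and ne: "label r (e v) \<noteq> label s (e v)"
      using rs en(1)[OF v] by blast
    have low: "X z v \<le> F (X z) v" if "label z (e v) = 0" for z
      using that en(2)[OF v] by (auto simp: label_def X_def split: if_splits)
    have high: "F (X z) v \<le> X z v"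
      if z: "\<forall>j<n. q j \<le> z j \<and> z j \<le> q j + 1" and l: "label z (e v) \<noteq> 0" for z
    proof (cases "z (e v) < p")
      case True
      then show ?thesis
        using l en(2)[OF v] by (auto simp: label_def X_def split: if_splits)
    next
      case False
      then have "X z v = 1"
        using step[OF z v] p by (simp add: X_def divide_le_eq_1 le_divide_eq_1)
      then show ?thesis
        using F[of "X z" v] step[OF z] v by auto
    qed
    \<comment> \<open>Kuhn's lemma does not tell which of its two points has label 0, so the claim
      is prepared for both orders.\<close>
    have goal: "\<exists>r s. (\<forall>u\<in>V. r u \<in> {0..1} \<and> \<bar>r u - X q u\<bar> \<le> 1 / real p) \<and>
           (\<forall>u\<in>V. s u \<in> {0..1} \<and> \<bar>s u - X q u\<bar> \<le> 1 / real p) \<and> r v \<le> F r v \<and> F s v \<le> s v"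
      if "\<forall>j<n. q j \<le> y j \<and> y j \<le> q j + 1" "\<forall>j<n. q j \<le> z j \<and> z j \<le> q j + 1"
        and "label y (e v) = 0" "label z (e v) \<noteq> 0" for y z
      using step[OF that(1)] step[OF that(2)] low[OF that(3)] high[OF that(2,4)]
      by (intro exI[of _ "X y"] exI[of _ "X z"] conjI ballI) auto
    show "\<exists>r s. (\<forall>u\<in>V. r u \<in> {0..1} \<and> \<bar>r u - X q u\<bar> \<le> 1 / real p) \<and>
           (\<forall>u\<in>V. s u \<in> {0..1} \<and> \<bar>s u - X q u\<bar> \<le> 1 / real p) \<and> r v \<le> F r v \<and> F s v \<le> s v"
    proof (cases "label r (e v) = 0")
      case True
      then show ?thesis
        using goal[OF r s] ne by simp
    next
      case False
      then have "label s (e v) = 0"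
        using ne by (auto simp: label_def split: if_splits)
      then show ?thesis
        using goal[OF s r] False by simp
    qed
  qed
qed

text \<open>Extending the barycentric parametrization of a polytope to a whole cube makes Kuhn's lemma on a
  grid applicable, whose dimension is a number; the Brouwer theorem of the library fixes the
  dimension by the type.\<close>

definition cone_point :: "'a::real_vector set \<Rightarrow> ('a \<Rightarrow> real) \<Rightarrow> 'a" where
  "cone_point V x = (1 / max 1 (sum x V)) *\<^sub>R (\<Sum>v\<in>V. x v *\<^sub>R v)"

text \<open>If the coordinates have sum T > 0, the point lies on the segment from 0 to the convex
  combination with weights \<open>x v / T\<close>, at the fraction
  \<open>T / max 1 T\<close>.\<close>

lemma cone_point_in_hull:
  assumes V: "finite V" and x: "\<And>v. v \<in> V \<Longrightarrow> 0 \<le> x v"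
  shows "cone_point V x \<in> convex hull (insert 0 V)"
proof (cases "sum x V = 0")
  case True
  then have "\<forall>v\<in>V. x v = 0"
    using V x by (simp add: sum_nonneg_eq_0_iff)
  then show ?thesis
    by (simp add: cone_point_def hull_inc)
next
  case False
  define T where "T = sum x V"
  have T: "T > 0"
    using False x by (simp add: T_def sum_nonneg order.not_eq_order_implies_strict)
  have "(\<Sum>v\<in>V. (x v / T) *\<^sub>R v) \<in> convex hull (insert 0 V)"
    using V x T by (intro convex_sum) (auto simp: hull_inc T_def simp flip: sum_divide_distrib)
  then have "(T / max 1 T) *\<^sub>R (\<Sum>v\<in>V. (x v / T) *\<^sub>R v) \<in> convex hull (insert 0 V)"
    using convexD_alt[of "convex hull (insert 0 V)" 0 _ "T / max 1 T"] T
    by (auto simp: hull_inc divide_le_eq_1 less_max_iff_disj)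
  also have "(T / max 1 T) *\<^sub>R (\<Sum>v\<in>V. (x v / T) *\<^sub>R v) = cone_point V x"
    using T by (auto simp: cone_point_def T_def[symmetric] scaleR_sum_right)
  finally show ?thesis .
qed

text \<open>The numerator and the denominator \<open>max 1 (sum x V)\<close> both vary by a
  controlled amount; each contributes \<open>R * (card V * d)\<close>.\<close>

lemma cone_point_close:
  fixes V :: "'a::real_normed_vector set" and R d :: real
  assumes V: "finite V" and R: "\<And>v. v \<in> V \<Longrightarrow> norm v \<le> R" "0 \<le> R"
    and x: "\<And>v. v \<in> V \<Longrightarrow> 0 \<le> x v" and y: "\<And>v. v \<in> V \<Longrightarrow> 0 \<le> y v"
    and xy: "\<And>v. v \<in> V \<Longrightarrow> \<bar>x v - y v\<bar> \<le> d"
  shows "norm (cone_point V x - cone_point V y) \<le> 2 * R * (card V * d)"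
proof -
  let ?S = "\<lambda>x. \<Sum>v\<in>V. x v *\<^sub>R v" and ?N = "\<lambda>x. max 1 (sum x V)"
  have S: "norm (?S x - ?S y) \<le> R * (card V * d)"
  proof -
    have "norm (?S x - ?S y) = norm (\<Sum>v\<in>V. (x v - y v) *\<^sub>R v)"
      by (simp add: scaleR_left_diff_distrib sum_subtractf)
    also have "\<dots> \<le> (\<Sum>v\<in>V. d * R)"
      using xy R by (intro sum_norm_le) (auto intro!: mult_mono order_trans[OF abs_ge_zero xy])
    finally show ?thesis
      by (simp add: mult_ac)
  qed
  have "\<bar>sum x V - sum y V\<bar> \<le> (\<Sum>v\<in>V. d)"
    unfolding sum_subtractf[symmetric] using xy by (intro order_trans[OF sum_abs] sum_mono)
  then have N: "\<bar>?N y - ?N x\<bar> \<le> card V * d"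
    by auto
  have Sy: "norm (?S y) \<le> R * ?N y"
  proof -
    have "norm (?S y) \<le> (\<Sum>v\<in>V. y v * R)"
      using y R by (intro sum_norm_le) (auto intro!: mult_left_mono)
    also have "\<dots> \<le> ?N y * R"
      using R(2) by (simp flip: sum_distrib_right add: mult_right_mono)
    finally show ?thesis
      by (simp add: mult_ac)
  qed
  \<comment> \<open>The change of denominator multiplies \<open>?S y\<close> divided by
    \<open>?N y\<close>, a vector of norm at most \<open>R\<close>. The outer factor is at most 1
    since \<open>?N x\<close> is at least 1.\<close>
  have "cone_point V x - cone_point V y
      = (1 / ?N x) *\<^sub>R ((?S x - ?S y) + ((?N y - ?N x) / ?N y) *\<^sub>R ?S y)"
    by (simp add: cone_point_def algebra_simps diff_divide_distrib)
  also have "norm \<dots> \<le> norm ((?S x - ?S y) + ((?N y - ?N x) / ?N y) *\<^sub>R ?S y)"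
    by (simp add: divide_le_eq mult_le_cancel_left1 mult_left_le_one_le)
  also have "\<dots> \<le> R * (card V * d) + \<bar>?N y - ?N x\<bar> / ?N y * norm (?S y)"
    using S by (intro order_trans[OF norm_triangle_ineq] add_mono) (auto simp: abs_mult)
  also have "\<bar>?N y - ?N x\<bar> / ?N y * norm (?S y) \<le> \<bar>?N y - ?N x\<bar> / ?N y * (R * ?N y)"
    using Sy by (intro mult_left_mono) auto
  also have "\<bar>?N y - ?N x\<bar> / ?N y * (R * ?N y) = R * \<bar>?N y - ?N x\<bar>"
    by (simp add: field_simps)
  also have "\<dots> \<le> R * (card V * d)"
    using N R(2) by (rule mult_left_mono)
  finally show ?thesis
    by (simp add: mult_ac)
qed

text \<open>The weights define a self-map of the polytope, the vertex 0 absorbing the weight missing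
  to 1. Composed with \<open>cone_point\<close> they give a self-map of the cube, and Kuhn's lemma
  on a fine grid yields \<open>x\<close> with \<open>x v\<close> close to \<open>w v a\<close>,
  where \<open>a = cone_point V x\<close>. The coordinates then sum to hardly more than 1, so
  normalization barely matters and \<open>a\<close> is almost fixed.\<close>

lemma brouwer_weights_approx:
  fixes V :: "'a::real_normed_vector set" and w :: "'a \<Rightarrow> 'a \<Rightarrow> real"
  defines "C \<equiv> convex hull (insert 0 V)"
  assumes V: "finite V"
    and cont: "\<And>v. v \<in> V \<Longrightarrow> continuous_on C (w v)"
    and nonneg: "\<And>v a. \<lbrakk>v \<in> V; a \<in> C\<rbrakk> \<Longrightarrow> 0 \<le> w v a"
    and le1: "\<And>a. a \<in> C \<Longrightarrow> (\<Sum>v\<in>V. w v a) \<le> 1"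
    and e: "e > 0"
  shows "\<exists>a\<in>C. norm (a - (\<Sum>v\<in>V. w v a *\<^sub>R v)) \<le> e"
proof -
  have C: "compact C"
    using V by (simp add: C_def finite_imp_compact_convex_hull)
  obtain R where R: "R > 0" "\<And>v. v \<in> V \<Longrightarrow> norm v \<le> R" "\<And>a. a \<in> C \<Longrightarrow> norm a \<le> R"
  proof -
    obtain R where "R > 0" "\<forall>a\<in>C. norm a \<le> R"
      using compact_imp_bounded[OF C] bounded_pos by blast
    then show ?thesis
      using that unfolding C_def by (simp add: hull_inc)
  qed
  \<comment> \<open>The summand 1 keeps \<open>m\<close> positive for empty \<open>V\<close>. With
    this \<open>\<theta>\<close> the two final errors \<open>2 * m * \<theta> * R\<close> add up to
    \<open>e\<close>.\<close>
  define m where "m = real (card V) + 1"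
  define \<theta> where "\<theta> = e / (4 * R * m)"
  have pos: "m > 0" "\<theta> > 0"
    using R(1) e by (auto simp: m_def \<theta>_def)
  have "\<exists>d>0. \<forall>v\<in>V. \<forall>a\<in>C. \<forall>b\<in>C. dist a b < d \<longrightarrow> dist (w v a) (w v b) < \<theta>"
  proof (cases "V = {}")
    case False
    have "\<exists>d>0. \<forall>a\<in>C. \<forall>b\<in>C. dist a b < d \<longrightarrow> dist (w v a) (w v b) < \<theta>" if "v \<in> V" for v
      using compact_uniformly_continuous[OF cont[OF that] C] pos(2)
      unfolding uniformly_continuous_on_def by meson
    then obtain d where d: "\<And>v. v \<in> V \<Longrightarrow> d v > 0 \<and>
        (\<forall>a\<in>C. \<forall>b\<in>C. dist a b < d v \<longrightarrow> dist (w v a) (w v b) < \<theta>)"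
      by metis
    show ?thesis
      using V False d by (intro exI[of _ "Min (d ` V)"]) auto
  qed (auto intro: exI[of _ 1])
  then obtain d where d: "d > 0"
    "\<And>v a b. \<lbrakk>v \<in> V; a \<in> C; b \<in> C; dist a b < d\<rbrakk> \<Longrightarrow> \<bar>w v a - w v b\<bar> < \<theta>"
    unfolding dist_real_def by metis
  \<comment> \<open>The mesh \<open>1 / p\<close> is below \<open>\<theta>\<close> and so fine that
    a grid step moves \<open>cone_point\<close> by less than the modulus of continuity
    \<open>d\<close>.\<close>
  obtain p :: nat where p: "real p > max (1 / \<theta>) (2 * R * m / d)"
    using reals_Archimedean2 by blast
  have p0: "p > 0"
    using p pos by (intro Nat.gr0I) auto
  have p1: "1 / real p < \<theta>" and p2: "2 * R * (m * (1 / real p)) < d"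
    using p p0 pos d(1) by (auto simp: field_simps)
  let ?F = "\<lambda>x v. w v (cone_point V x)"
  have CP: "cone_point V x \<in> C" if "\<And>u. u \<in> V \<Longrightarrow> x u \<in> {0..1}" for x
    unfolding C_def using V that by (intro cone_point_in_hull) auto
  have F01: "?F x v \<in> {0..1}" if x: "\<And>u. u \<in> V \<Longrightarrow> x u \<in> {0..1}" and v: "v \<in> V" for x v
  proof -
    have xC: "cone_point V x \<in> C"
      using CP[of x] x by blast
    have "w v (cone_point V x) \<le> (\<Sum>v\<in>V. w v (cone_point V x))"
      using V v nonneg xC by (intro member_le_sum) auto
    then show ?thesis
      using nonneg[OF v xC] le1[OF xC] by auto
  qed
  obtain x where x: "\<forall>v\<in>V. x v \<in> {0..1}"
    and rs: "\<forall>v\<in>V. \<exists>r s. (\<forall>u\<in>V. r u \<in> {0..1} \<and> \<bar>r u - x u\<bar> \<le> 1 / real p) \<and>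
           (\<forall>u\<in>V. s u \<in> {0..1} \<and> \<bar>s u - x u\<bar> \<le> 1 / real p) \<and> r v \<le> ?F r v \<and> ?F s v \<le> s v"
    by (rule kuhn_grid[OF V p0, of ?F, OF F01])
  define a where "a = cone_point V x"
  have aC: "a \<in> C"
    unfolding a_def using CP x by blast
  have near: "\<bar>w v (cone_point V y) - w v a\<bar> < \<theta>"
    if v: "v \<in> V" and y: "\<forall>u\<in>V. y u \<in> {0..1} \<and> \<bar>y u - x u\<bar> \<le> 1 / real p" for y v
  proof -
    have "norm (cone_point V y - a) \<le> 2 * R * (card V * (1 / real p))"
      unfolding a_def using V R x y by (intro cone_point_close) auto
    also have "\<dots> \<le> 2 * R * (m * (1 / real p))"
      using R(1) by (intro mult_left_mono mult_right_mono) (auto simp: m_def)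
    finally show ?thesis
      using p2 d(2)[OF v CP aC] y by (simp add: dist_norm)
  qed
  \<comment> \<open>The point \<open>r\<close> bounds \<open>x v\<close> from above and
    \<open>s\<close> from below, each up to one \<open>\<theta>\<close> for the mesh and one for the
    variation of \<open>w v\<close>.\<close>
  have xw: "\<bar>x v - w v a\<bar> \<le> 2 * \<theta>" if v: "v \<in> V" for v
  proof -
    obtain r s where r: "\<forall>u\<in>V. r u \<in> {0..1} \<and> \<bar>r u - x u\<bar> \<le> 1 / real p"
      and s: "\<forall>u\<in>V. s u \<in> {0..1} \<and> \<bar>s u - x u\<bar> \<le> 1 / real p"
      and le: "r v \<le> ?F r v" "?F s v \<le> s v"
      using bspec[OF rs v] by blast
    have "\<bar>r v - x v\<bar> \<le> 1 / real p" "\<bar>s v - x v\<bar> \<le> 1 / real p"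
      using r s v by auto
    then show ?thesis
      using near[OF v r] near[OF v s] le p1 by linarith
  qed
  have sumx: "sum x V \<le> 1 + 2 * m * \<theta>"
  proof -
    have "sum x V \<le> (\<Sum>v\<in>V. w v a + 2 * \<theta>)"
      using xw by (intro sum_mono) (smt (verit))
    also have "\<dots> \<le> 1 + 2 * m * \<theta>"
      using le1[OF aC] pos by (simp add: sum.distrib m_def algebra_simps)
    finally show ?thesis .
  qed
  have "norm (a - (\<Sum>v\<in>V. x v *\<^sub>R v)) \<le> 2 * m * \<theta> * R"
  proof -
    let ?N = "max 1 (sum x V)"
    have "(\<Sum>v\<in>V. x v *\<^sub>R v) = ?N *\<^sub>R a"
      by (simp add: a_def cone_point_def)
    then have "norm (a - (\<Sum>v\<in>V. x v *\<^sub>R v)) = norm ((1 - ?N) *\<^sub>R a)"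
      by (simp add: algebra_simps)
    also have "\<dots> \<le> (2 * m * \<theta>) * R"
      unfolding norm_scaleR using sumx R aC pos by (intro mult_mono) (auto simp: abs_if)
    finally show ?thesis .
  qed
  moreover have "norm ((\<Sum>v\<in>V. x v *\<^sub>R v) - (\<Sum>v\<in>V. w v a *\<^sub>R v)) \<le> 2 * m * \<theta> * R"
  proof -
    have "norm ((\<Sum>v\<in>V. x v *\<^sub>R v) - (\<Sum>v\<in>V. w v a *\<^sub>R v)) = norm (\<Sum>v\<in>V. (x v - w v a) *\<^sub>R v)"
      by (simp add: scaleR_left_diff_distrib sum_subtractf)
    also have "\<dots> \<le> (\<Sum>v\<in>V. 2 * \<theta> * R)"
      using xw R pos by (intro sum_norm_le) (auto intro!: mult_mono)
    also have "\<dots> \<le> 2 * m * \<theta> * R"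
      using pos R(1) by (simp add: m_def algebra_simps)
    finally show ?thesis .
  qed
  ultimately have "norm (a - (\<Sum>v\<in>V. w v a *\<^sub>R v)) \<le> 2 * m * \<theta> * R + 2 * m * \<theta> * R"
    by (rule norm_diff_triangle_le)
  also have "\<dots> = e"
    using R(1) pos by (simp add: \<theta>_def)
  finally show ?thesis
    using aC by blast
qed

text \<open>The displacement attains its minimum on the compact polytope. A positive minimum would
  contradict the existence of points with half that displacement.\<close>

theorem brouwer_weights:
  fixes V :: "'a::real_normed_vector set" and w :: "'a \<Rightarrow> 'a \<Rightarrow> real"
  defines "C \<equiv> convex hull (insert 0 V)"
  assumes V: "finite V"
    and cont: "\<And>v. v \<in> V \<Longrightarrow> continuous_on C (w v)"
    and nonneg: "\<And>v a. \<lbrakk>v \<in> V; a \<in> C\<rbrakk> \<Longrightarrow> 0 \<le> w v a"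
    and le1: "\<And>a. a \<in> C \<Longrightarrow> (\<Sum>v\<in>V. w v a) \<le> 1"
  obtains a where "a \<in> C" "(\<Sum>v\<in>V. w v a *\<^sub>R v) = a"
proof -
  let ?h = "\<lambda>a. norm (a - (\<Sum>v\<in>V. w v a *\<^sub>R v))"
  have "compact C" "C \<noteq> {}"
    using V by (auto simp: C_def finite_imp_compact_convex_hull)
  moreover have "continuous_on C ?h"
    using cont by (intro continuous_intros)
  ultimately have "\<exists>a\<in>C. \<forall>b\<in>C. ?h a \<le> ?h b"
    by (rule continuous_attains_inf)
  then obtain a where a: "a \<in> C" "\<forall>b\<in>C. ?h a \<le> ?h b"
    by blast
  have "?h a \<le> 0"
  proof (rule ccontr)
    assume "\<not> ?h a \<le> 0"
    then have "?h a / 2 > 0"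
      by simp
    have "\<exists>b\<in>C. ?h b \<le> ?h a / 2"
      unfolding C_def
      using V cont[unfolded C_def] nonneg[unfolded C_def] le1[unfolded C_def] \<open>?h a / 2 > 0\<close>
      by (rule brouwer_weights_approx)
    then obtain b where "b \<in> C" "?h b \<le> ?h a / 2"
      by blast
    then show False
      using bspec[OF a(2), of b] \<open>?h a / 2 > 0\<close> by linarith
  qed
  then show ?thesis
    using that a(1) by simp
qed

section \<open>Nets of balls modulo a subspace of finite codimension\<close>

text \<open>Total boundedness of balls in the quotient by \<open>S\<close>. A non-closed
  \<open>S\<close> gives only a seminorm there, so the nets are expressed by vectors of the space
  itself.\<close>

definition totally_bounded_mod :: "'a::real_normed_vector set \<Rightarrow> bool" where
  "totally_bounded_mod S \<longleftrightarrow>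
     (\<forall>r. \<forall>\<eta>>0. \<exists>W. finite W \<and> (\<forall>x. norm x \<le> r \<longrightarrow> (\<exists>v\<in>W. \<exists>s\<in>S. norm (x - v - s) \<le> \<eta>)))"

lemma totally_bounded_mod_UNIV: "totally_bounded_mod UNIV"
  unfolding totally_bounded_mod_def
proof (intro allI impI exI conjI)
  show "\<exists>v\<in>{0}. \<exists>s\<in>UNIV. norm (x - v - s) \<le> \<eta>" if "0 < \<eta>" for x :: 'a and \<eta> :: real
    using that by (auto intro!: exI[of _ x])
qed auto

text \<open>If \<open>b\<close> has positive distance from \<open>S\<close>, its coefficient in a
  bounded vector of the span is bounded, and the net is enlarged by a finite net of coefficients.
  Otherwise \<open>b\<close> lies in the closure of \<open>S\<close>, its multiples can be replaced
  by elements of \<open>S\<close> at arbitrarily small cost, and the old net serves.\<close>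

lemma totally_bounded_mod_span_insert:
  assumes T: "totally_bounded_mod (span (insert b S))" and S: "subspace S"
  shows "totally_bounded_mod S"
  unfolding totally_bounded_mod_def
proof (intro allI impI)
  fix r \<eta> :: real
  assume \<eta>: "\<eta> > 0"
  obtain W where W: "finite W"
    "\<And>x. norm x \<le> r \<Longrightarrow> \<exists>v\<in>W. \<exists>s\<in>span (insert b S). norm (x - v - s) \<le> \<eta> / 2"
    using T \<eta> unfolding totally_bounded_mod_def by (meson half_gt_zero)
  have span: "\<exists>c. s - c *\<^sub>R b \<in> S" if "s \<in> span (insert b S)" for s
    using that span_eq_iff[THEN iffD2, OF S] unfolding span_breakdown_eq by auto
  show "\<exists>W. finite W \<and> (\<forall>x. norm x \<le> r \<longrightarrow> (\<exists>v\<in>W. \<exists>s\<in>S. norm (x - v - s) \<le> \<eta>))"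
  proof (cases "\<exists>d>0. \<forall>s\<in>S. d \<le> norm (b - s)")
    case True
    then obtain d where d: "d > 0" "\<And>s. s \<in> S \<Longrightarrow> d \<le> norm (b - s)"
      by blast
    have coeff: "\<bar>c\<bar> * d \<le> norm (c *\<^sub>R b + s)" if "s \<in> S" for c s
    proof (cases "c = 0")
      case False
      have "- (1 / c) *\<^sub>R s \<in> S"
        using S that by (simp add: subspace_scale subspace_neg)
      then have "\<bar>c\<bar> * d \<le> \<bar>c\<bar> * norm (b - - (1 / c) *\<^sub>R s)"
        by (intro mult_left_mono d(2)) auto
      also have "\<dots> = norm (c *\<^sub>R (b - - (1 / c) *\<^sub>R s))"
        by simp
      also have "c *\<^sub>R (b - - (1 / c) *\<^sub>R s) = c *\<^sub>R b + s"
        using False by (simp add: algebra_simps)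
      finally show ?thesis .
    qed auto
    obtain m where m: "\<And>v. v \<in> W \<Longrightarrow> norm v \<le> m"
      using finite_imp_bounded[OF W(1)] by (auto simp: bounded_iff)
    \<comment> \<open>\<open>k\<close> bounds the coefficient of \<open>b\<close> in any
      \<open>s\<close> within \<open>\<eta> / 2\<close> of \<open>x - v\<close>; an error
      \<open>\<delta>\<close> in this coefficient costs at most \<open>\<eta> / 2\<close>.\<close>
    define k where "k = (r + m + \<eta> / 2) / d"
    define \<delta> where "\<delta> = \<eta> / 2 / (norm b + 1)"
    have \<delta>: "\<delta> > 0" "\<delta> * norm b \<le> \<eta> / 2"
      using \<eta> by (auto simp: \<delta>_def field_simps add_pos_nonneg)
    obtain Z where Z: "finite Z" "{-k..k} \<subseteq> (\<Union>z\<in>Z. ball z \<delta>)"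
      using compact_Icc[of "-k" k] \<delta>(1) unfolding compact_eq_totally_bounded by blast
    show ?thesis
    proof (intro exI conjI allI impI)
      show "finite ((\<lambda>(v, z). v + z *\<^sub>R b) ` (W \<times> Z))"
        using W Z by auto
      fix x :: 'a
      assume x: "norm x \<le> r"
      obtain v s where v: "v \<in> W" and s: "s \<in> span (insert b S)" "norm (x - v - s) \<le> \<eta> / 2"
        using W(2)[OF x] by blast
      obtain c where c: "s - c *\<^sub>R b \<in> S"
        using span[OF s(1)] by blast
      have "\<bar>c\<bar> * d \<le> norm s"
        using coeff[OF c, of c] by simp
      also have "s = x - v - (x - v - s)"
        by simp
      also have "norm \<dots> \<le> r + m + \<eta> / 2"
        using x m[OF v] s(2) norm_triangle_ineq4[of x v] norm_triangle_ineq4[of "x - v" "x - v - s"]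
        by linarith
      finally have "\<bar>c\<bar> \<le> k"
        using d(1) by (simp add: k_def field_simps)
      then obtain z where z: "z \<in> Z" "\<bar>z - c\<bar> < \<delta>"
        using subsetD[OF Z(2), of c] by (auto simp: dist_real_def abs_le_iff)
      have "norm (x - (v + z *\<^sub>R b) - (s - c *\<^sub>R b)) = norm ((x - v - s) + (c - z) *\<^sub>R b)"
        by (simp add: algebra_simps)
      also have "\<dots> \<le> \<eta> / 2 + \<delta> * norm b"
        using s(2) z(2) by (intro order_trans[OF norm_triangle_ineq] add_mono) (auto intro!: mult_right_mono)
      also have "\<dots> \<le> \<eta>"
        using \<delta>(2) by simp
      finally show "\<exists>v\<in>(\<lambda>(v, z). v + z *\<^sub>R b) ` (W \<times> Z). \<exists>s\<in>S. norm (x - v - s) \<le> \<eta>"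
        using c v z(1) by force
    qed
  next
    case False
    show ?thesis
    proof (intro exI conjI allI impI)
      show "finite W" by fact
      fix x :: 'a
      assume x: "norm x \<le> r"
      obtain v s where v: "v \<in> W" and s: "s \<in> span (insert b S)" "norm (x - v - s) \<le> \<eta> / 2"
        using W(2)[OF x] by blast
      obtain c where c: "s - c *\<^sub>R b \<in> S"
        using span[OF s(1)] by blast
      have "\<eta> / 2 / (\<bar>c\<bar> + 1) > 0"
        using \<eta> by (simp add: add_nonneg_pos)
      \<comment> \<open>The approximant \<open>b'\<close> may depend on \<open>c\<close>, hence on
        \<open>x\<close>, since only the net has to be uniform.\<close>
      then obtain b' where b': "b' \<in> S" "norm (b - b') < \<eta> / 2 / (\<bar>c\<bar> + 1)"
        using False by (meson not_le)
      have "\<bar>c\<bar> * norm (b - b') \<le> (\<bar>c\<bar> + 1) * (\<eta> / 2 / (\<bar>c\<bar> + 1))"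
        using b'(2) by (intro mult_mono) auto
      also have "\<dots> = \<eta> / 2"
        using abs_ge_zero[of c]
        by (subst times_divide_eq_right, intro nonzero_mult_div_cancel_left) linarith
      finally have "norm ((x - v - s) + c *\<^sub>R (b - b')) \<le> \<eta> / 2 + \<eta> / 2"
        using s(2) by (intro order_trans[OF norm_triangle_ineq] add_mono) auto
      also have "(x - v - s) + c *\<^sub>R (b - b') = x - v - ((s - c *\<^sub>R b) + c *\<^sub>R b')"
        by (simp add: algebra_simps)
      finally show "\<exists>v\<in>W. \<exists>s\<in>S. norm (x - v - s) \<le> \<eta>"
        using v S c b'(1) by (auto intro!: bexI[OF _ v] subspace_add subspace_scale)
    qed
  qed
qed

text \<open>The claim is trivial modulo the whole space; the vectors of \<open>B\<close> are then
  removed from the spanning set one at a time.\<close>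

lemma finite_codim_imp_totally_bounded_mod:
  assumes "finite_codim_subspace S"
  shows "totally_bounded_mod S"
proof -
  obtain B where S: "subspace S" and B: "finite B" "span (S \<union> B) = UNIV"
    using assms by (auto simp: finite_codim_subspace_def)
  have "totally_bounded_mod (span (S \<union> B)) \<longrightarrow> totally_bounded_mod (span S)"
    using B(1)
  proof induction
    case (insert b B)
    have "span (insert b (span (S \<union> B))) = span (S \<union> insert b B)"
      by (simp add: set_eq_iff span_breakdown_eq span_span)
    then show ?case
      using insert totally_bounded_mod_span_insert[of b "span (S \<union> B)"] by auto
  qed auto
  then show ?thesis
    unfolding span_eq_iff[THEN iffD2, OF S] using B(2) totally_bounded_mod_UNIV by auto
qed

text \<open>Each centre of a net for \<open>\<eta> / 2\<close> is replaced by a point of the ball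
  near it modulo \<open>S\<close>, which doubles the error. Centres inside the ball keep their
  convex hull inside it.\<close>

lemma finite_codim_ball_net:
  assumes "finite_codim_subspace S" "\<eta> > 0"
  obtains V where "finite V" "V \<subseteq> cball 0 r"
    and "\<And>x. norm x \<le> r \<Longrightarrow> \<exists>v\<in>V. \<exists>s\<in>S. norm (x - v - s) \<le> \<eta>"
proof -
  have S: "subspace S"
    using assms by (simp add: finite_codim_subspace_def)
  obtain W where W: "finite W" "\<And>x. norm x \<le> r \<Longrightarrow> \<exists>v\<in>W. \<exists>s\<in>S. norm (x - v - s) \<le> \<eta> / 2"
    using finite_codim_imp_totally_bounded_mod[OF assms(1)] assms(2)
    unfolding totally_bounded_mod_def by (meson half_gt_zero)
  define near where "near v y \<longleftrightarrow> norm y \<le> r \<and> (\<exists>s\<in>S. norm (y - v - s) \<le> \<eta> / 2)" for v y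
  define c where "c v = (SOME y. near v y)" for v
  have c: "near v (c v)" if "near v y" for v y
    unfolding c_def using that by (rule someI)
  show ?thesis
  proof (rule that[of "c ` {v \<in> W. \<exists>y. near v y}"])
    show "c ` {v \<in> W. \<exists>y. near v y} \<subseteq> cball 0 r"
      using c unfolding near_def by force
    fix x :: 'a
    assume x: "norm x \<le> r"
    then obtain v s where v: "v \<in> W" and s: "s \<in> S" "norm (x - v - s) \<le> \<eta> / 2"
      using W(2) by blast
    then have nx: "near v x"
      using x by (auto simp: near_def)
    then obtain s' where s': "s' \<in> S" "norm (c v - v - s') \<le> \<eta> / 2"
      using c near_def by blast
    have "norm (x - c v - (s - s')) = norm ((x - v - s) - (c v - v - s'))"
      by (simp add: algebra_simps)
    also have "\<dots> \<le> \<eta>"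
      using s(2) s'(2) norm_triangle_ineq4[of "x - v - s" "c v - v - s'"] by linarith
    finally show "\<exists>v\<in>c ` {v \<in> W. \<exists>y. near v y}. \<exists>s\<in>S. norm (x - v - s) \<le> \<eta>"
      using v nx subspace_diff[OF S s(1) s'(1)] by blast
  qed (use W in auto)
qed

section \<open>A Gorelik principle on a compact polytope\<close>

text \<open>\<open>C\<close> is the hull of 0 and a net of the ball modulo \<open>X0\<close>, chosen
  before \<open>\<Phi>\<close>. The net represents each \<open>a - \<Phi> a\<close> up to error 1;
  if the representative is \<open>a\<close> itself, then \<open>\<Phi> a\<close> is near
  \<open>X0\<close>.\<close>

lemma gorelik_compact:
  fixes X0 :: "'a::real_normed_vector set"
  assumes X0: "finite_codim_subspace X0" and t: "0 \<le> t"
  obtains C where "compact C" "C \<subseteq> cball 0 t"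
    and "\<And>\<Phi> c. \<lbrakk>\<And>a b. dist (\<Phi> a) (\<Phi> b) \<le> c * dist a b + c; 0 \<le> c;
            \<And>a. a \<in> C \<Longrightarrow> norm (\<Phi> a - a) \<le> t\<rbrakk> \<Longrightarrow> \<exists>a\<in>C. \<exists>x\<in>X0. norm (\<Phi> a - x) \<le> 2 * c + 2"
proof -
  have sub: "subspace X0"
    using X0 by (simp add: finite_codim_subspace_def)
  obtain V where V: "finite V" "V \<subseteq> cball 0 t"
    and net: "\<And>x. norm x \<le> t \<Longrightarrow> \<exists>v\<in>V. \<exists>s\<in>X0. norm (x - v - s) \<le> 1"
    using finite_codim_ball_net[OF X0 zero_less_one, of t] by metis
  define C where "C = convex hull (insert 0 V)"
  have C: "compact C"
    using V by (simp add: C_def finite_imp_compact_convex_hull)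
  then obtain J where J: "finite J" "J \<subseteq> C" "C \<subseteq> (\<Union>j\<in>J. ball j 1)"
    using seq_compact_imp_totally_bounded[of C] compact_imp_seq_compact by (metis zero_less_one)
  \<comment> \<open>Tent functions on the unit balls around \<open>J\<close>, normalized to a
    partition of unity; the balls cover \<open>C\<close>, so the denominator is positive
    there.\<close>
  define \<mu> where "\<mu> j a = max 0 (1 - dist a j)" for j a :: 'a
  define \<nu> where "\<nu> j a = \<mu> j a / (\<Sum>i\<in>J. \<mu> i a)" for j a
  have spos: "0 < (\<Sum>i\<in>J. \<mu> i a)" if "a \<in> C" for a
  proof -
    obtain j where "j \<in> J" "dist a j < 1"
      using subsetD[OF J(3) \<open>a \<in> C\<close>] by (auto simp: dist_commute)
    then show ?thesis
      using J(1) by (intro sum_pos2[of _ j]) (auto simp: \<mu>_def)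
  qed
  have \<nu>_nonneg: "0 \<le> \<nu> j a" for j a
    by (auto simp: \<nu>_def \<mu>_def intro!: divide_nonneg_nonneg sum_nonneg)
  have \<nu>_sum: "(\<Sum>j\<in>J. \<nu> j a) = 1" if "a \<in> C" for a
    using spos[OF that] by (simp add: \<nu>_def flip: sum_divide_distrib)
  have \<nu>_cont: "continuous_on C (\<nu> j)" for j
    unfolding \<nu>_def \<mu>_def
    using spos unfolding \<mu>_def by (intro continuous_intros) (metis less_irrefl)
  show ?thesis
  proof (rule that[OF C])
    show "C \<subseteq> cball 0 t"
      unfolding C_def using V(2) t by (intro hull_minimal) auto
    fix \<Phi> :: "'a \<Rightarrow> 'a" and c :: real
    assume \<Phi>: "\<And>a b. dist (\<Phi> a) (\<Phi> b) \<le> c * dist a b + c" and c: "0 \<le> c"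
      and disp: "\<And>a. a \<in> C \<Longrightarrow> norm (\<Phi> a - a) \<le> t"
    have "\<forall>j\<in>C. \<exists>v s. v \<in> V \<and> s \<in> X0 \<and> norm (j - \<Phi> j - v - s) \<le> 1"
      using net disp by (metis norm_minus_commute)
    then obtain b s where b: "\<And>j. j \<in> C \<Longrightarrow> b j \<in> V" and s: "\<And>j. j \<in> C \<Longrightarrow> s j \<in> X0"
      and bs: "\<And>j. j \<in> C \<Longrightarrow> norm (j - \<Phi> j - b j - s j) \<le> 1"
      by metis
    \<comment> \<open>\<open>a \<mapsto> \<Sum>w v a v\<close> smooths the discontinuous map sending \<open>j\<close> to a point of \<open>V\<close> congruent to
      \<open>j - \<Phi> j\<close> modulo \<open>X0\<close>, up to distance 1; its fixed point is nearly sent into \<open>X0\<close> by \<open>\<Phi>\<close>.\<close>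
    define w where "w v a = (\<Sum>j | j \<in> J \<and> b j = v. \<nu> j a)" for v a
    have group: "(\<Sum>v\<in>V. \<Sum>j | j \<in> J \<and> b j = v. h j) = sum h J" for h :: "'a \<Rightarrow> 'z::comm_monoid_add"
      using V(1) J b by (intro sum.group) auto
    have "(\<Sum>v\<in>V. w v a) \<le> 1" if "a \<in> C" for a
      using \<nu>_sum[OF that] by (simp add: w_def group)
    moreover have "0 \<le> w v a" for v a
      using \<nu>_nonneg by (simp add: w_def sum_nonneg)
    moreover have "continuous_on C (w v)" for v
      unfolding w_def by (intro continuous_on_sum \<nu>_cont)
    ultimately obtain a where a: "a \<in> C" "(\<Sum>v\<in>V. w v a *\<^sub>R v) = a"
      using brouwer_weights[OF V(1), of w] unfolding C_def by metis
    have "(\<Sum>v\<in>V. w v a *\<^sub>R v) = (\<Sum>v\<in>V. \<Sum>j | j \<in> J \<and> b j = v. \<nu> j a *\<^sub>R b j)"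
      by (simp add: w_def scaleR_sum_left)
    then have ab: "(\<Sum>j\<in>J. \<nu> j a *\<^sub>R b j) = a"
      using a(2) unfolding group by simp
    have const: "(\<Sum>j\<in>J. \<nu> j a *\<^sub>R z) = z" for z :: 'a
      using \<nu>_sum[OF a(1)] by (simp flip: scaleR_sum_left)
    define x where "x = (\<Sum>j\<in>J. \<nu> j a *\<^sub>R (- s j))"
    have "x \<in> X0"
      unfolding x_def using s J(2) sub by (intro subspace_sum subspace_scale subspace_neg) auto
    moreover have "norm (\<Phi> a - x) \<le> 2 * c + 2"
    proof -
      \<comment> \<open>The added difference vanishes, since both of its sums equal
        \<open>a\<close>. It turns the left side into an average of small vectors.\<close>
      have "\<Phi> a - x = (\<Sum>j\<in>J. \<nu> j a *\<^sub>R \<Phi> a) - x + ((\<Sum>j\<in>J. \<nu> j a *\<^sub>R b j) - (\<Sum>j\<in>J. \<nu> j a *\<^sub>R a))"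
        by (simp add: const ab)
      also have "\<dots> = (\<Sum>j\<in>J. \<nu> j a *\<^sub>R ((\<Phi> a - \<Phi> j) - (j - \<Phi> j - b j - s j) + (j - a)))"
        unfolding x_def by (simp add: sum.distrib sum_subtractf sum_negf algebra_simps)
      also have "norm \<dots> \<le> (\<Sum>j\<in>J. \<nu> j a * (2 * c + 2))"
      proof (rule sum_norm_le)
        fix j assume j: "j \<in> J"
        show "norm (\<nu> j a *\<^sub>R ((\<Phi> a - \<Phi> j) - (j - \<Phi> j - b j - s j) + (j - a))) \<le> \<nu> j a * (2 * c + 2)"
        \<comment> \<open>Only net points closer than 1 to \<open>a\<close> carry weight; for them
          the three summands contribute \<open>2 * c\<close>, 1 and 1.\<close>
        proof (cases "dist a j < 1")
          case True
          have "c * dist a j \<le> c * 1"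
            using True c by (intro mult_left_mono) auto
          then have "norm (\<Phi> a - \<Phi> j) \<le> 2 * c"
            using \<Phi>[of a j] by (simp add: dist_norm)
          moreover have "norm (j - \<Phi> j - b j - s j) \<le> 1" "norm (j - a) \<le> 1"
            using bs j J(2) True by (auto simp: dist_norm norm_minus_commute)
          ultimately have "norm ((\<Phi> a - \<Phi> j) - (j - \<Phi> j - b j - s j) + (j - a)) \<le> 2 * c + 2"
            using norm_triangle_ineq4[of "\<Phi> a - \<Phi> j" "j - \<Phi> j - b j - s j"]
              norm_triangle_ineq[of "(\<Phi> a - \<Phi> j) - (j - \<Phi> j - b j - s j)" "j - a"]
            by linarith
          then show ?thesis
            using \<nu>_nonneg[of j a] by (simp add: mult_left_mono)
        qed (simp add: \<nu>_def \<mu>_def)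
      qed
      also have "\<dots> = 2 * c + 2"
        using \<nu>_sum[OF a(1)] by (simp flip: sum_distrib_right)
      finally show ?thesis .
    qed
    ultimately show "\<exists>a\<in>C. \<exists>x\<in>X0. norm (\<Phi> a - x) \<le> 2 * c + 2"
      using a(1) by blast
  qed
qed

section \<open>Linear bounds for coarse Lipschitz maps\<close>

lemma coarse_lipschitz_ge1:
  assumes "coarse_lipschitz f" "coarse_lipschitz g"
  obtains L where "1 \<le> L" "\<And>x y. dist (f x) (f y) \<le> L * dist x y + L"
    "\<And>x y. dist (g x) (g y) \<le> L * dist x y + L"
proof -
  obtain A B where A: "\<And>x y. dist (f x) (f y) \<le> A * dist x y + A"
    and B: "\<And>x y. dist (g x) (g y) \<le> B * dist x y + B"
    using assms unfolding coarse_lipschitz_def by blast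
  define L where "L = max 1 (max A B)"
  have mono: "K * d + K \<le> L * d + L" if "K \<le> L" "0 \<le> d" for K d
    using that by (intro add_mono mult_right_mono)
  show ?thesis
    by (rule that[of L]) (auto simp: L_def intro: order_trans[OF A mono[unfolded L_def]]
        order_trans[OF B mono[unfolded L_def]])
qed

text \<open>Asymptotic closeness controls the distance far out. On the remaining bounded region the
  coarse Lipschitz bounds control it, and \<open>D\<close> absorbs the result; a bounded space
  consists of this region alone.\<close>

lemma asymptotically_close_linear_bound:
  fixes f g :: "'a::real_normed_vector \<Rightarrow> 'b::metric_space"
  assumes close: "asymptotically_close f g" and f: "coarse_lipschitz f" and g: "coarse_lipschitz g"
    and \<eta>: "0 < \<eta>"
  obtains D where "0 \<le> D" "\<And>x. dist (f x) (g x) \<le> \<eta> * norm x + D"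
proof -
  obtain L where L: "1 \<le> L" "\<And>x y. dist (f x) (f y) \<le> L * dist x y + L"
    "\<And>x y. dist (g x) (g y) \<le> L * dist x y + L"
    using coarse_lipschitz_ge1[OF f g] by metis
  have "\<exists>\<rho> E. 0 \<le> E \<and> (\<forall>x. norm x \<le> \<rho> \<or> dist (f x) (g x) \<le> \<eta> * norm x + E)"
    using close unfolding asymptotically_close_def
  proof (elim disjE exE)
    assume "bounded (UNIV :: 'a set)"
    then show ?thesis
      by (auto simp: bounded_iff)
  next
    fix x0 :: 'a
    assume "((\<lambda>x. dist (f x) (g x) / dist x x0) \<longlongrightarrow> 0) (filtercomap (\<lambda>x. dist x x0) at_top)"
    then have "\<forall>\<^sub>F x in filtercomap (\<lambda>x. dist x x0) at_top. dist (f x) (g x) / dist x x0 < \<eta>"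
      using \<eta> by (rule order_tendstoD)
    then obtain N where N: "\<And>x. N \<le> dist x x0 \<Longrightarrow> dist (f x) (g x) / dist x x0 < \<eta>"
      unfolding eventually_filtercomap_at_top_linorder by blast
    show ?thesis
    proof (intro exI conjI allI)
      fix x
      \<comment> \<open>The term \<open>\<eta> * norm x0\<close> pays for moving the base point to
        0. The radius also covers \<open>x = x0\<close>, where the quotient is 0 by convention and
        its bound says nothing.\<close>
      show "norm x \<le> max N 1 + norm x0 \<or> dist (f x) (g x) \<le> \<eta> * norm x + \<eta> * norm x0"
      proof (rule disjCI)
        assume "\<not> dist (f x) (g x) \<le> \<eta> * norm x + \<eta> * norm x0"
        then have "\<eta> * dist x x0 < dist (f x) (g x)"
          using \<eta> norm_triangle_ineq4[of x x0] mult_left_mono[of "dist x x0" "norm x + norm x0" \<eta>]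
          by (simp add: dist_norm distrib_left)
        then have "\<not> (N \<le> dist x x0 \<and> 0 < dist x x0)"
          using N[of x] by (auto simp: divide_less_eq split: if_splits)
        then have "dist x x0 \<le> max N 1"
          by linarith
        then show "norm x \<le> max N 1 + norm x0"
          using norm_triangle_sub[of x x0] by (simp add: dist_norm)
      qed
    qed (use \<eta> in simp)
  qed
  then obtain \<rho> E where E: "0 \<le> E" "\<And>x. norm x \<le> \<rho> \<or> dist (f x) (g x) \<le> \<eta> * norm x + E"
    by blast
  define F where "F = 2 * (L * \<bar>\<rho>\<bar> + L) + dist (f 0) (g 0)"
  have F: "0 \<le> F"
    using L(1) by (simp add: F_def)
  show ?thesis
  proof (rule that[of "E + F"])
    show "0 \<le> E + F"
      using E(1) F by simp
    fix x :: 'a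
    show "dist (f x) (g x) \<le> \<eta> * norm x + (E + F)"
    proof (cases "norm x \<le> \<rho>")
      case True
      have "dist (f x) (g x) \<le> dist (f x) (f 0) + dist (f 0) (g 0) + dist (g 0) (g x)"
        by (meson add_right_mono dist_triangle order_trans)
      also have "\<dots> \<le> 2 * (L * norm x + L) + dist (f 0) (g 0)"
        using L(2)[of x 0] L(3)[of 0 x] by simp
      also have "\<dots> \<le> F"
        unfolding F_def using True L(1) by (auto intro!: mult_left_mono)
      finally show ?thesis
        using E(1) \<eta> by (simp add: add_increasing)
    next
      case False
      then show ?thesis
        using E(2)[of x] F by auto
    qed
  qed
qed

section \<open>Covering a ball of the target by means of the Gorelik principle\<close>

theorem theorem5p10:
  assumes "asymptotically_coarse_lipschitz_equivalent TYPE('a::banach) TYPE('b::banach)"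
  shows "\<exists>f :: 'a \<Rightarrow> 'b. asymptotic_coarse_lipschitz_equivalence f \<and>
    (\<exists>M\<ge>1::real. \<forall>\<epsilon>>0::real. \<exists>t0>0::real.
      \<forall>X0 :: 'a set. finite_codim_subspace X0 \<longrightarrow>
        (\<forall>t>t0. \<exists>K :: 'b set. compact K \<and>
          (*\<^sub>R) (t / M) ` cball 0 1 \<subseteq>
            K + (*\<^sub>R) (\<epsilon> * t) ` cball 0 1 + f ` ((*\<^sub>R) (2 * t) ` (cball 0 1 \<inter> X0))))"
proof -
  obtain f :: "'a \<Rightarrow> 'b" and g where equiv: "asymptotic_coarse_lipschitz_equivalence f"
    and fg: "coarse_lipschitz f" "coarse_lipschitz g"
      "asymptotically_close (g \<circ> f) id" "asymptotically_close (f \<circ> g) id"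
    using assms
    unfolding asymptotically_coarse_lipschitz_equivalent_def asymptotic_coarse_lipschitz_equivalence_def
    by blast
  obtain L where L: "1 \<le> L" and fL: "\<And>x y. dist (f x) (f y) \<le> L * dist x y + L"
    and gL: "\<And>x y. dist (g x) (g y) \<le> L * dist x y + L"
    using coarse_lipschitz_ge1[OF fg(1,2)] by metis
  have cl_id: "coarse_lipschitz (id :: 'z::metric_space \<Rightarrow> 'z)"
    unfolding coarse_lipschitz_def by (auto intro: exI[of _ 1])
  \<comment> \<open>A coarse Lipschitz constant for compositions of \<open>f\<close> and
    \<open>g\<close>, and for \<open>a \<mapsto> g (y + f a)\<close>, since translations preserve
    distances.\<close>
  define c where "c = L * L + L"
  have c: "0 \<le> c" "L \<le> c" "L * L \<le> c"
    using L by (auto simp: c_def)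
  have comp: "L * d' + L \<le> c * d + c" if "d' \<le> L * d + L" "0 \<le> d" for d d'
  proof -
    have "L * d' + L \<le> L * (L * d + L) + L"
      using that(1) L by (intro add_right_mono mult_left_mono) auto
    also have "\<dots> = (L * L) * d + c"
      by (simp add: c_def algebra_simps)
    also have "\<dots> \<le> c * d + c"
      using c that(2) by (intro add_right_mono mult_right_mono) auto
    finally show ?thesis .
  qed
  have "0 < c"
    using L c by linarith
  have cl_gf: "coarse_lipschitz (g \<circ> f)" and cl_fg: "coarse_lipschitz (f \<circ> g)"
    unfolding coarse_lipschitz_def comp_apply
    using \<open>0 < c\<close> by (auto intro!: exI[of _ c] order_trans[OF gL] order_trans[OF fL] comp fL gL)
  \<comment> \<open>Displacement budget: \<open>t / 4\<close> comes from \<open>y\<close>,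
    \<open>t / 8\<close> from this slope, and \<open>H\<close> below keeps the constants under
    another \<open>t / 8\<close>.\<close>
  obtain D1 where D1: "0 \<le> D1" "\<And>x. dist (g (f x)) x \<le> 1 / 8 * norm x + D1"
    using asymptotically_close_linear_bound[OF fg(3) cl_gf cl_id, of "1 / 8"] by auto
  have "\<exists>t0>0. \<forall>X0. finite_codim_subspace X0 \<longrightarrow>
        (\<forall>t>t0. \<exists>K :: 'b set. compact K \<and>
          (*\<^sub>R) (t / (4 * L)) ` cball 0 1 \<subseteq>
            K + (*\<^sub>R) (\<epsilon> * t) ` cball 0 1 + f ` ((*\<^sub>R) (2 * t) ` (cball 0 1 \<inter> X0)))"
    if \<epsilon>: "0 < \<epsilon>" for \<epsilon> :: real
  proof -
    \<comment> \<open>The norm of \<open>y + f a\<close> is at most \<open>(1 + L) * t\<close> plus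
      a constant, so this slope costs \<open>\<epsilon> * t / 2\<close>. The other half is left for
      \<open>G\<close>, which collects all errors independent of \<open>t\<close>.\<close>
    define \<eta> where "\<eta> = \<epsilon> / (2 * (1 + L))"
    have \<eta>: "0 < \<eta>" "\<eta> * (1 + L) = \<epsilon> / 2"
      using \<epsilon> L by (auto simp: \<eta>_def field_simps)
    obtain D2 where D2: "0 \<le> D2" "\<And>y. dist (f (g y)) y \<le> \<eta> * norm y + D2"
      using asymptotically_close_linear_bound[OF fg(4) cl_fg cl_id \<eta>(1)] by auto
    define G where "G = 3 * L + L * (2 * c + 2) + \<eta> * (L + norm (f 0)) + D2"
    define H where "H = 8 * (L + D1 + 2 * c + 2)"
    have G: "0 \<le> G"
      using L c D2(1) \<eta>(1) by (auto simp: G_def)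
    have H: "0 < H"
      using L c D1(1) by (auto simp: H_def)
    show ?thesis
    proof (intro exI[of _ "H + 2 * G / \<epsilon>"] conjI allI impI)
      show "0 < H + 2 * G / \<epsilon>"
        using G H \<epsilon> by (simp add: add_pos_nonneg)
      fix X0 :: "'a set" and t
      assume X0: "finite_codim_subspace X0" and t: "H + 2 * G / \<epsilon> < t"
      have tH: "H \<le> t" and t0: "0 < t"
        using t G H \<epsilon> divide_nonneg_pos[of "2 * G" \<epsilon>] by linarith+
      have tH': "L + D1 + 2 * c + 2 \<le> t / 8"
        using tH by (simp add: H_def)
      have "2 * G / \<epsilon> \<le> t"
        using t H by linarith
      then have tG: "G \<le> \<epsilon> * t / 2"
        using \<epsilon> by (simp add: field_simps)
      \<comment> \<open>\<open>C\<close> and its net \<open>J\<close> are fixed before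
        \<open>y\<close>, so the compact set depends only on \<open>X0\<close> and
        \<open>t\<close>.\<close>
      obtain C where C: "compact C" "C \<subseteq> cball 0 t"
        and gorelik: "\<And>\<Phi> c. \<lbrakk>\<And>a b. dist (\<Phi> a) (\<Phi> b) \<le> c * dist a b + c; 0 \<le> c;
            \<And>a. a \<in> C \<Longrightarrow> norm (\<Phi> a - a) \<le> t\<rbrakk> \<Longrightarrow> \<exists>a\<in>C. \<exists>x\<in>X0. norm (\<Phi> a - x) \<le> 2 * c + 2"
        using gorelik_compact[OF X0, of t] t0 by (metis less_imp_le)
      obtain J where J: "finite J" "C \<subseteq> (\<Union>j\<in>J. ball j 1)"
        using C(1) unfolding compact_eq_totally_bounded by (meson zero_less_one)
      show "\<exists>K :: 'b set. compact K \<and> (*\<^sub>R) (t / (4 * L)) ` cball 0 1 \<subseteq>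
            K + (*\<^sub>R) (\<epsilon> * t) ` cball 0 1 + f ` ((*\<^sub>R) (2 * t) ` (cball 0 1 \<inter> X0))"
      proof (intro exI[of _ "(\<lambda>j. - f j) ` J"] conjI subsetI)
        show "compact ((\<lambda>j. - f j) ` J)"
          using J(1) by (simp add: finite_imp_compact)
        fix y assume "y \<in> (*\<^sub>R) (t / (4 * L)) ` cball (0 :: 'b) 1"
        then have y: "norm y \<le> t / (4 * L)"
          using t0 L by (auto simp: divide_le_eq mult_left_le)
        then have Ly: "L * norm y \<le> t / 4"
          using L by (simp add: field_simps)
        have y_le: "norm y \<le> t"
          using Ly L t0 mult_right_mono[of 1 L "norm y"] by simp
        let ?\<Phi> = "\<lambda>a. g (y + f a)"
        have disp: "norm (?\<Phi> a - a) \<le> t / 4 + L + t / 8 + D1" if "a \<in> C" for a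
        proof -
          have "norm a \<le> t"
            using that C(2) by auto
          moreover have "dist (?\<Phi> a) (g (f a)) \<le> L * norm y + L"
            using gL[of "y + f a" "f a"] by (simp add: dist_norm)
          ultimately show ?thesis
            using D1(2)[of a] Ly dist_triangle[of "?\<Phi> a" a "g (f a)"] by (simp add: dist_norm)
        qed
        have "\<exists>a\<in>C. \<exists>x\<in>X0. norm (?\<Phi> a - x) \<le> 2 * c + 2"
        proof (rule gorelik)
          show "dist (?\<Phi> a) (?\<Phi> b) \<le> c * dist a b + c" for a b
            using fL by (intro order_trans[OF gL] comp) auto
          show "norm (?\<Phi> a - a) \<le> t" if "a \<in> C" for a
            using disp[OF that] tH' t0 c(1) L D1(1) by linarith
        qed (rule c(1))
        then obtain a x where a: "a \<in> C" and x: "x \<in> X0" and ax: "norm (?\<Phi> a - x) \<le> 2 * c + 2"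
          by blast
        have a_le: "norm a \<le> t"
          using a C(2) by auto
        \<comment> \<open>The displacement of \<open>a\<close> and the distance to \<open>x\<close>
          together stay below \<open>t / 2\<close>, so the norm of \<open>x\<close> is at most
          \<open>3 * t / 2\<close>.\<close>
        have x_le: "norm x \<le> 2 * t"
        proof -
          have "norm x \<le> norm (?\<Phi> a - x) + (norm (?\<Phi> a - a) + norm a)"
            using norm_triangle_ineq4[of "a + (?\<Phi> a - a)" "?\<Phi> a - x"] norm_triangle_ineq[of a "?\<Phi> a - a"]
            by simp
          then show ?thesis
            using ax a_le disp[OF a] tH' t0 c(1) L D1(1) by linarith
        qed
        obtain j where j: "j \<in> J" "dist a j < 1"
          using subsetD[OF J(2) \<open>a \<in> C\<close>] by (auto simp: dist_commute)
        \<comment> \<open>The error term: it splits into \<open>f j - f a\<close>, from passing to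
          the net, and \<open>y + f a - f x\<close>, from the round trip through \<open>g\<close>
          and the distance to \<open>x\<close>.\<close>
        define u where "u = y + f j - f x"
        have fj: "norm (f j - f a) \<le> 2 * L"
        proof -
          have "L * dist j a \<le> L * 1"
            using j(2) L by (intro mult_left_mono) (auto simp: dist_commute)
          then show ?thesis
            using fL[of j a] by (simp add: dist_norm)
        qed
        have fa: "norm (y + f a) \<le> t + (L * t + L + norm (f 0))"
        proof -
          have "norm (f a) \<le> norm (f 0) + (L * norm a + L)"
            using fL[of a 0] norm_triangle_sub[of "f a" "f 0"] by (simp add: dist_norm)
          moreover have "L * norm a \<le> L * t"
            using a_le L by (intro mult_left_mono) auto
          ultimately show ?thesis
            using norm_triangle_ineq[of y "f a"] y_le by linarith
        qed
        have roundtrip: "dist (f (?\<Phi> a)) (y + f a) \<le> \<epsilon> * t / 2 + \<eta> * (L + norm (f 0)) + D2"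
        proof -
          have "\<eta> * norm (y + f a) \<le> \<eta> * (t + (L * t + L + norm (f 0)))"
            using fa \<eta>(1) by (intro mult_left_mono) auto
          also have "\<dots> = (\<eta> * (1 + L)) * t + \<eta> * (L + norm (f 0))"
            by (simp add: algebra_simps)
          finally show ?thesis
            using D2(2)[of "y + f a"] \<eta>(2) by simp
        qed
        have fx: "dist (f x) (f (?\<Phi> a)) \<le> L * (2 * c + 2) + L"
          using ax L by (intro order_trans[OF fL] add_right_mono mult_left_mono)
            (auto simp: dist_norm norm_minus_commute)
        have "norm u \<le> norm (f j - f a) + norm (y + f a - f x)"
          unfolding u_def using norm_triangle_ineq[of "f j - f a" "y + f a - f x"] by (simp add: algebra_simps)
        also have "norm (y + f a - f x) \<le> dist (f x) (f (?\<Phi> a)) + dist (f (?\<Phi> a)) (y + f a)"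
          by (metis dist_commute dist_norm dist_triangle)
        finally have "norm u \<le> \<epsilon> * t / 2 + G"
          using fj fx roundtrip unfolding G_def by linarith
        then have "norm u \<le> \<epsilon> * t"
          using tG by simp
        moreover have "0 < \<epsilon> * t"
          using \<epsilon> t0 by simp
        ultimately have u: "u \<in> (*\<^sub>R) (\<epsilon> * t) ` cball 0 1"
          by (intro image_eqI[of _ _ "(1 / (\<epsilon> * t)) *\<^sub>R u"]) (auto simp: divide_le_eq)
        have "x \<in> (*\<^sub>R) (2 * t) ` (cball 0 1 \<inter> X0)"
          using x x_le t0 X0 unfolding finite_codim_subspace_def
          by (intro image_eqI[of _ _ "(1 / (2 * t)) *\<^sub>R x"]) (auto simp: divide_le_eq subspace_scale)
        moreover have "y = - f j + u + f x"
          by (simp add: u_def)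
        ultimately show "y \<in> (\<lambda>j. - f j) ` J + (*\<^sub>R) (\<epsilon> * t) ` cball 0 1
            + f ` ((*\<^sub>R) (2 * t) ` (cball 0 1 \<inter> X0))"
          using j(1) u by (metis imageI set_plus_intro)
      qed
    qed
  qed
  then show ?thesis
    using equiv L by (intro exI[of _ f] conjI exI[of _ "4 * L"]) auto
qed

end
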